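(* There does not exist an anti-pre-Lie algebraic structure $\circ$ on the Virasoro algebra $\mathcal{V}$ for which there are functions $\phi':\mathbb{Z}\times\mathbb{Z}\to\mathbb{C}$ and $\phi:\mathbb{Z}\times\mathbb{Z}\to\mathbb{C}$ such that, for all $m,n\in\mathbb{Z}$, $$W_n\circ W_m=\phi'(n,m)W_{m+n}+\phi(n,m)\delta_{m+n,0}\mathbf{c},\qquad W_n\circ\mathbf{c}=\mathbf{c}\circ W_n=\mathbf{c}\circ\mathbf{c}=0.$$
   Context: All vector spaces and algebras are over $\mathbb{C}$. An anti-pre-Lie algebra is a vector space $A$ with a bilinear operation $\circ$ such that, with $[x,y]=x\circ y-y\circ x$, for all $x,y,z\in A$: $x\circ(y\circ z)-y\circ(x\circ z)=[y,x]\circ z$ and $[[x,y],z]+[[y,z],x]+[[z,x],y]=0$. The commutator $[\cdot,\cdot]$ then is a Lie bracket on $A$, and $(A,\circ)$ is called an anti-pre-Lie algebraic structure on a Lie algebra $\mathfrak{g}$ if the underlying vector space of $\mathfrak g$ is $A$ and the Lie bracket of $\mathfrak g$ is this commutator. The Virasoro algebra $\mathcal{V}$ is the Lie algebra with basis $\{W_m : m\in\mathbb{Z}\}\cup\{\mathbf{c}\}$ and bracket $[W_m,W_n]=(n-m)W_{m+n}+\delta_{m+n,0}\frac{m^3-m}{12}\mathbf{c}$, $[W_m,\mathbf{c}]=0$ for all $m,n\in\mathbb{Z}$. *)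

theory Defs
  imports Complex_Main "HOL-Library.Poly_Mapping"
begin

section \<open>Complex algebras\<close>

text \<open>Vector spaces are the library's \<^locale>\<open>vector_space\<close>, with a complex scalar
  multiplication, on a whole type. They may be infinite-dimensional.\<close>

locale complex_algebra = vector_space scale
  for scale :: "complex \<Rightarrow> 'a::ab_group_add \<Rightarrow> 'a" +
  fixes mul :: "'a \<Rightarrow> 'a \<Rightarrow> 'a"
  assumes linear_mul_right: "Vector_Spaces.linear scale scale (\<lambda>y. mul x y)"
    and linear_mul_left: "Vector_Spaces.linear scale scale (\<lambda>x. mul x y)"

locale complex_lie_algebra = complex_algebra scale bracket
  for scale :: "complex \<Rightarrow> 'a::ab_group_add \<Rightarrow> 'a"
    and bracket :: "'a \<Rightarrow> 'a \<Rightarrow> 'a" +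
  assumes bracket_self: "bracket x x = 0"
    and jacobi:
      "bracket (bracket x y) z + bracket (bracket y z) x + bracket (bracket z x) y = 0"

definition commutator :: "('a \<Rightarrow> 'a \<Rightarrow> 'a::ab_group_add) \<Rightarrow> 'a \<Rightarrow> 'a \<Rightarrow> 'a" where
  "commutator mul x y = mul x y - mul y x"

locale anti_pre_lie_algebra = complex_algebra scale circ
  for scale :: "complex \<Rightarrow> 'a::ab_group_add \<Rightarrow> 'a"
    and circ :: "'a \<Rightarrow> 'a \<Rightarrow> 'a" +
  assumes anti_pre_lie:
      "circ x (circ y z) - circ y (circ x z) = circ (commutator circ y x) z"
    and commutator_jacobi:
      "commutator circ (commutator circ x y) z + commutator circ (commutator circ y z) x
        + commutator circ (commutator circ z x) y = 0"

definition anti_pre_lie_structure_on ::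
  "(complex \<Rightarrow> 'a \<Rightarrow> 'a) \<Rightarrow> ('a \<Rightarrow> 'a \<Rightarrow> 'a::ab_group_add) \<Rightarrow> ('a \<Rightarrow> 'a \<Rightarrow> 'a) \<Rightarrow> bool"
where
  "anti_pre_lie_structure_on scale bracket circ \<longleftrightarrow>
     complex_lie_algebra scale bracket \<and> anti_pre_lie_algebra scale circ \<and>
     (\<forall>x y. bracket x y = commutator circ x y)"


section \<open>The Virasoro algebra\<close>

text \<open>\<open>W_inj\<close> and \<open>c_notin\<close> say that the family consisting of all \<open>W m\<close> and \<open>c\<close> has no
  repetitions, so that together with the next two assumptions the family is a basis.
  The locale determines the Lie algebra up to a unique isomorphism preserving \<open>W\<close> and \<open>c\<close>.\<close>

locale virasoro_algebra = complex_lie_algebra scale bracket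
  for scale :: "complex \<Rightarrow> 'a::ab_group_add \<Rightarrow> 'a"
    and bracket :: "'a \<Rightarrow> 'a \<Rightarrow> 'a" +
  fixes W :: "int \<Rightarrow> 'a" and c :: 'a
  assumes W_inj: "inj W"
    and c_notin: "c \<notin> range W"
    and basis_independent: "independent (insert c (range W))"
    and basis_span: "span (insert c (range W)) = UNIV"
    and bracket_W_W: "bracket (W m) (W n) =
      scale (of_int (n - m)) (W (m + n))
      + scale (of_bool (m + n = 0) * ((of_int m ^ 3 - of_int m) / 12)) c"
    and bracket_W_c: "bracket (W m) c = 0"


section \<open>A model\<close>

text \<open>Finitely supported functions on the index set \<open>int option\<close>, where \<open>Some m\<close> is the
  index of \<open>W m\<close> and \<open>None\<close> that of \<open>c\<close>, realise the locale.\<close>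

lift_definition fs_scale :: "complex \<Rightarrow> ('k \<Rightarrow>\<^sub>0 complex) \<Rightarrow> ('k \<Rightarrow>\<^sub>0 complex)"
  is "\<lambda>a f k. a * f k"
  by (rule finite_subset) auto

lemma lookup_fs_scale [simp]: "Poly_Mapping.lookup (fs_scale a f) k = a * Poly_Mapping.lookup f k"
  by transfer simp

interpretation fs: vector_space "fs_scale :: complex \<Rightarrow> ('k \<Rightarrow>\<^sub>0 complex) \<Rightarrow> _"
  by unfold_locales (auto intro!: poly_mapping_eqI simp: lookup_add algebra_simps)

abbreviation fs_unit :: "'k \<Rightarrow> 'k \<Rightarrow>\<^sub>0 complex" where
  "fs_unit k \<equiv> Poly_Mapping.single k 1"

definition fs_lift :: "('k \<Rightarrow> 'l \<Rightarrow>\<^sub>0 complex) \<Rightarrow> ('k \<Rightarrow>\<^sub>0 complex) \<Rightarrow> ('l \<Rightarrow>\<^sub>0 complex)" where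
  "fs_lift h f = (\<Sum>k\<in>Poly_Mapping.keys f. fs_scale (Poly_Mapping.lookup f k) (h k))"

lemma fs_lift_superset:
  assumes "finite A" "Poly_Mapping.keys f \<subseteq> A"
  shows "fs_lift h f = (\<Sum>k\<in>A. fs_scale (Poly_Mapping.lookup f k) (h k))"
  unfolding fs_lift_def using assms
  by (intro sum.mono_neutral_left) (auto simp: in_keys_iff)

lemma fs_linearI:
  assumes "\<And>x y. F (x + y) = F x + F y" "\<And>a x. F (fs_scale a x) = fs_scale a (F x)"
  shows "Vector_Spaces.linear fs_scale fs_scale F"
  by unfold_locales (use assms in auto)

lemma fs_linearD:
  assumes "Vector_Spaces.linear fs_scale fs_scale F"
  shows "F (x + y) = F x + F y" "F (fs_scale a x) = fs_scale a (F x)"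
    "F (sum g A) = (\<Sum>i\<in>A. F (g i))"
proof -
  interpret Vector_Spaces.linear fs_scale fs_scale F by fact
  show "F (x + y) = F x + F y" "F (fs_scale a x) = fs_scale a (F x)"
    "F (sum g A) = (\<Sum>i\<in>A. F (g i))"
    by (rule add scale sum)+
qed

lemma fs_lift_linear: "Vector_Spaces.linear fs_scale fs_scale (fs_lift h)"
proof (rule fs_linearI)
  fix x y :: "'a \<Rightarrow>\<^sub>0 complex" and a
  let ?A = "Poly_Mapping.keys x \<union> Poly_Mapping.keys y"
  have "Poly_Mapping.keys (x + y) \<subseteq> ?A" by (rule Poly_Mapping.keys_add)
  then show "fs_lift h (x + y) = fs_lift h x + fs_lift h y"
    by (simp add: fs_lift_superset[of ?A] lookup_add fs.scale_left_distrib sum.distrib)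
  have "Poly_Mapping.keys (fs_scale a x) \<subseteq> Poly_Mapping.keys x" by (auto simp: in_keys_iff)
  then show "fs_lift h (fs_scale a x) = fs_scale a (fs_lift h x)"
    by (simp add: fs_lift_superset[of "Poly_Mapping.keys x"] fs.scale_sum_right)
qed

lemma fs_lift_unit [simp]: "fs_lift h (fs_unit k) = h k"
  by (simp add: fs_lift_def)

lemma fs_expand: "x = fs_lift fs_unit x"
proof (rule poly_mapping_eqI)
  fix k
  have "(\<Sum>i\<in>Poly_Mapping.keys x. Poly_Mapping.lookup x i * Poly_Mapping.lookup (fs_unit i) k)
      = (\<Sum>i\<in>Poly_Mapping.keys x. if k = i then Poly_Mapping.lookup x i else 0)"
    by (intro sum.cong) (auto simp: lookup_single when_def)
  then show "Poly_Mapping.lookup x k = Poly_Mapping.lookup (fs_lift fs_unit x) k"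
    by (simp add: fs_lift_def lookup_sum in_keys_iff)
qed

lemma fs_linear_eqI:
  assumes "Vector_Spaces.linear fs_scale fs_scale F" "Vector_Spaces.linear fs_scale fs_scale G"
    and "\<And>k. F (fs_unit k) = G (fs_unit k)"
  shows "F x = G x"
  using fs_expand[of x] unfolding fs_lift_def
  by (metis (no_types, lifting) assms fs_linearD(2,3) sum.cong)

fun vir_unit_bracket :: "int option \<Rightarrow> int option \<Rightarrow> int option \<Rightarrow>\<^sub>0 complex" where
  "vir_unit_bracket (Some m) (Some n) =
     fs_scale (of_int (n - m)) (fs_unit (Some (m + n)))
     + fs_scale (of_bool (m + n = 0) * ((of_int m ^ 3 - of_int m) / 12)) (fs_unit None)"
| "vir_unit_bracket _ _ = 0"

definition vir_bracket ::
  "(int option \<Rightarrow>\<^sub>0 complex) \<Rightarrow> (int option \<Rightarrow>\<^sub>0 complex) \<Rightarrow> (int option \<Rightarrow>\<^sub>0 complex)"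
where
  "vir_bracket x y = fs_lift (\<lambda>i. fs_lift (vir_unit_bracket i) y) x"

lemma vir_bracket_unit [simp]:
  "vir_bracket (fs_unit i) (fs_unit j) = vir_unit_bracket i j"
  by (simp add: vir_bracket_def)

lemma vir_bracket_linear_left: "Vector_Spaces.linear fs_scale fs_scale (\<lambda>x. vir_bracket x y)"
  unfolding vir_bracket_def by (rule fs_lift_linear)

lemma vir_bracket_linear_right: "Vector_Spaces.linear fs_scale fs_scale (vir_bracket x)"
  by (rule fs_linearI)
    (simp_all add: vir_bracket_def fs_linearD[OF fs_lift_linear]
      fs_lift_def[where f = x] fs.scale_right_distrib sum.distrib fs.scale_sum_right
      mult.commute)

lemmas vir_bracket_simps =
  fs_linearD(1,2)[OF vir_bracket_linear_left] fs_linearD(1,2)[OF vir_bracket_linear_right]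

lemma vir_bracket_zero [simp]: "vir_bracket 0 y = 0" "vir_bracket x 0 = 0"
  using vir_bracket_simps(2)[of 0 0 y] vir_bracket_simps(4)[of x 0 0] by simp_all

lemma vir_bracket_anticommute: "vir_bracket x y = - vir_bracket y x"
proof -
  have unit: "vir_unit_bracket i j = - vir_unit_bracket j i" for i j
  proof (cases "i = None \<or> j = None")
    case True
    then show ?thesis by (cases i; cases j) simp_all
  next
    case False
    then obtain m n where ij: "i = Some m" "j = Some n" by auto
    have c: "of_bool (n + m = 0) * ((of_int n ^ 3 - of_int n) / 12)
        = - (of_bool (m + n = 0) * ((of_int m ^ 3 - of_int m) / 12) :: complex)"
    proof (cases "m + n = 0")
      case True
      then have "n = - m" by simp
      then show ?thesis by (simp add: power3_eq_cube field_simps)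
    qed (simp add: add.commute)
    have W: "of_int (m - n) = - (of_int (n - m) :: complex)" by simp
    show ?thesis
      unfolding ij vir_unit_bracket.simps W c fs.scale_minus_left
      by (simp only: minus_add_distrib minus_minus add.commute)
  qed
  have lin: "Vector_Spaces.linear fs_scale fs_scale (\<lambda>x. - vir_bracket x y)"
    "Vector_Spaces.linear fs_scale fs_scale (\<lambda>x. - vir_bracket y x)" for y
    by (rule fs_linearI; simp only: vir_bracket_simps minus_add_distrib fs.scale_minus_right)+
  have "vir_bracket (fs_unit i) y = - vir_bracket y (fs_unit i)" for i y
    by (rule fs_linear_eqI[OF vir_bracket_linear_right lin(1)])
      (unfold vir_bracket_unit, rule unit)
  then show ?thesis
    by (rule fs_linear_eqI[OF vir_bracket_linear_left lin(2)])
qed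

lemma vir_bracket_jacobi:
  "vir_bracket (vir_bracket x y) z + vir_bracket (vir_bracket y z) x
    + vir_bracket (vir_bracket z x) y = 0"
proof -
  let ?J = "\<lambda>x y z. vir_bracket (vir_bracket x y) z + vir_bracket (vir_bracket y z) x
    + vir_bracket (vir_bracket z x) y"
  have some: "vir_bracket (vir_unit_bracket (Some l) (Some m)) (fs_unit (Some n))
      = fs_scale (of_int (m - l) * of_int (n - l - m)) (fs_unit (Some (l + m + n)))
        + fs_scale (of_int (m - l) * of_bool (l + m + n = 0)
            * ((of_int (l + m) ^ 3 - of_int (l + m)) / 12)) (fs_unit None)" for l m n
    unfolding vir_unit_bracket.simps vir_bracket_simps vir_bracket_unit
    by (rule poly_mapping_eqI, unfold lookup_add lookup_fs_scale)
      (auto simp: lookup_single when_def field_simps)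
  have none: "vir_bracket (vir_unit_bracket i j) (fs_unit None) = 0" for i j
    by (cases i; cases j) (simp_all add: vir_bracket_simps)
  have unit: "?J (fs_unit i) (fs_unit j) (fs_unit k) = 0" for i j k
  proof (cases "i = None \<or> j = None \<or> k = None")
    case True
    then show ?thesis
      unfolding vir_bracket_unit
      by (cases i; cases j; cases k) (simp_all add: none del: vir_unit_bracket.simps(1))
  next
    case False
    then obtain l m n where ijk: "i = Some l" "j = Some m" "k = Some n" by auto
    show ?thesis
    proof (cases "l + m + n = 0")
      case True
      then have sums: "m + n + l = 0" "n + l + m = 0" and n: "n = - l - m" by simp_all
      have W: "(m - l) * (n - l - m) + (n - m) * (l - m - n) + (l - n) * (m - n - l) = 0"
        unfolding n by (simp add: algebra_simps)
      have c: "(m - l) * ((l + m) ^ 3 - (l + m)) + (n - m) * ((m + n) ^ 3 - (m + n))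
          + (l - n) * ((n + l) ^ 3 - (n + l)) = 0"
        unfolding n by (simp add: algebra_simps power3_eq_cube)
      have Wc: "of_int (m - l) * of_int (n - l - m) + of_int (n - m) * of_int (l - m - n)
          + of_int (l - n) * of_int (m - n - l) = (0 :: complex)"
        using arg_cong[OF W, of "of_int :: int \<Rightarrow> complex"]
        by (simp only: of_int_add of_int_mult of_int_0)
      have cc: "of_int (m - l) * ((of_int (l + m) ^ 3 - of_int (l + m)) / 12)
          + of_int (n - m) * ((of_int (m + n) ^ 3 - of_int (m + n)) / 12)
          + of_int (l - n) * ((of_int (n + l) ^ 3 - of_int (n + l)) / 12) = (0 :: complex)"
        using arg_cong[OF c, of "\<lambda>x. of_int x / 12 :: complex"]
        by (simp only: of_int_add of_int_mult of_int_diff of_int_power of_int_0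
            add_divide_distrib times_divide_eq_right div_0)
      show ?thesis
        unfolding ijk vir_bracket_unit some True sums
        by (rule poly_mapping_eqI, unfold lookup_add lookup_fs_scale)
          (use Wc cc in \<open>simp add: lookup_single when_def del: of_int_add of_int_diff\<close>)
    next
      case False
      then have sums: "m + n + l = l + m + n" "n + l + m = l + m + n" by simp_all
      have "(m - l) * (n - l - m) + (n - m) * (l - m - n) + (l - n) * (m - n - l) = 0"
        by (simp add: algebra_simps)
      from arg_cong[OF this, of "of_int :: int \<Rightarrow> complex"]
      have Wc: "of_int (m - l) * of_int (n - l - m) + of_int (n - m) * of_int (l - m - n)
          + of_int (l - n) * of_int (m - n - l) = (0 :: complex)"
        by (simp only: of_int_add of_int_mult of_int_0)
      show ?thesis
        unfolding ijk vir_bracket_unit some sums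
        by (rule poly_mapping_eqI, unfold lookup_add lookup_fs_scale)
          (use Wc False in \<open>simp add: lookup_single when_def del: of_int_add of_int_diff\<close>)
    qed
  qed
  have lin1: "Vector_Spaces.linear fs_scale fs_scale (\<lambda>x. ?J x y z)"
    and lin2: "Vector_Spaces.linear fs_scale fs_scale (\<lambda>y. ?J x y z)"
    and lin3: "Vector_Spaces.linear fs_scale fs_scale (\<lambda>z. ?J x y z)" for x y z
    by (auto intro!: fs_linearI simp: vir_bracket_simps fs.scale_right_distrib)
  have lin0: "Vector_Spaces.linear fs_scale fs_scale
      (\<lambda>_::int option \<Rightarrow>\<^sub>0 complex. 0 :: int option \<Rightarrow>\<^sub>0 complex)"
    by (auto intro!: fs_linearI)
  have "?J (fs_unit i) (fs_unit j) z = 0" for i j z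
    by (rule fs_linear_eqI[OF lin3 lin0 unit])
  then have "?J (fs_unit i) y z = 0" for i y z
    by (rule fs_linear_eqI[OF lin2 lin0])
  then show ?thesis
    by (rule fs_linear_eqI[OF lin1 lin0])
qed

theorem virasoro_algebra_model:
  "virasoro_algebra fs_scale vir_bracket (\<lambda>m. fs_unit (Some m)) (fs_unit None)"
proof -
  have basis: "insert (fs_unit None) (range (\<lambda>m::int. fs_unit (Some m))) = range fs_unit"
    by (auto simp: image_iff) (metis option.exhaust)
  have unit_eq: "fs_unit i = fs_unit j \<longleftrightarrow> i = j" for i j :: "int option"
    by (metis lookup_single_eq lookup_single_not_eq zero_neq_one)
  have zero: "u v = 0" if T: "finite T" "T \<subseteq> range fs_unit" "v \<in> T"
    and sum: "(\<Sum>v\<in>T. fs_scale (u v) v) = 0" for T u and v :: "int option \<Rightarrow>\<^sub>0 complex"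
  proof -
    obtain k where k: "v = fs_unit k" using T by auto
    have "Poly_Mapping.lookup w k = of_bool (w = v)" if "w \<in> T" for w
      using T(2) that unit_eq by (auto simp: k lookup_single when_def)
    then have "(\<Sum>w\<in>T. u w * Poly_Mapping.lookup w k) = (\<Sum>w\<in>T. if w = v then u w else 0)"
      by (intro sum.cong) auto
    with T sum show ?thesis
      by (metis (no_types, lifting) lookup_fs_scale lookup_sum lookup_zero sum.cong sum.delta)
  qed
  have span: "x \<in> fs.span (range fs_unit)" for x :: "int option \<Rightarrow>\<^sub>0 complex"
    by (subst fs_expand[of x], unfold fs_lift_def)
      (intro fs.span_sum fs.span_scale fs.span_base rangeI)
  show ?thesis
  proof unfold_locales
    show "vir_bracket x x = 0" for x
    proof (rule poly_mapping_eqI)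
      fix k
      have "Poly_Mapping.lookup (vir_bracket x x) k = - Poly_Mapping.lookup (vir_bracket x x) k"
        by (metis vir_bracket_anticommute lookup_uminus)
      then show "Poly_Mapping.lookup (vir_bracket x x) k = Poly_Mapping.lookup 0 k" by simp
    qed
    show "inj (\<lambda>m::int. fs_unit (Some m))" "fs_unit None \<notin> range (\<lambda>m::int. fs_unit (Some m))"
      by (auto simp: inj_on_def unit_eq)
    show "\<not> fs.dependent (insert (fs_unit None) (range (\<lambda>m::int. fs_unit (Some m))))"
      unfolding basis fs.dependent_explicit using zero by blast
    show "fs.span (insert (fs_unit None) (range (\<lambda>m::int. fs_unit (Some m)))) = UNIV"
      unfolding basis using span by blast
  qed (simp_all add: vir_bracket_simps vir_bracket_jacobi fs.scale_right_distrib)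
qed

end

(* Comparing coefficients, left multiplication makes the algebra a graded module over the Witt
   algebra with structure constants f, and the coefficients psi(n) of c in W_n o W_(-n) satisfy a
   twisted cocycle equation. Commutation with W_0 shows that a nonzero f(b,k) shifts the W_0-weight
   by -b; since f(m,n) and f(n,m) cannot both vanish for m ~= n, this forces f(0,k) = alpha - k.
   If alpha ~= 0, then psi(b) is proportional to f(b,-b), so psi(b) - psi(-b) is linear in b instead
   of cubic. If alpha = 0, then psi is odd, hence psi(n) = (n^3 - n)/24, which determines f(1,2),
   and this value violates the module equation for W_1, W_2 acting on W_0. *)

theory Submission
  imports Defs
begin

context
  fixes f :: "int \<Rightarrow> int \<Rightarrow> complex"
  assumes comm: "\<And>m n. f m n - f n m = of_int (n - m)"
    and action: "\<And>a b k. f b k * f a (b + k) - f a k * f b (a + k) = of_int (a - b) * f (a + b) k"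
begin

text \<open>With \<open>a = 0\<close> every term of \<open>action\<close> contains the factor
  \<open>f b k\<close>, which cancels.\<close>

lemma weight_shift:
  assumes "f b k \<noteq> 0"
  shows "f 0 (b + k) = f 0 k - of_int b"
proof -
  have "f b k * (f 0 (b + k) - f 0 k + of_int b) = 0"
    using action[of b k 0] by (simp add: algebra_simps)
  with assms have "f 0 (b + k) - f 0 k + of_int b = 0" by simp
  then show ?thesis by (simp add: eq_diff_eq diff_add_eq)
qed

text \<open>If \<open>f k 0\<close> vanishes, \<open>comm\<close> alone fixes \<open>f 0 k\<close>;
  otherwise the weight shift starting from index 0 does.\<close>

lemma weight_dichotomy: "f 0 k = f 0 0 - of_int k \<or> f 0 k = of_int k"
proof (cases "f k 0 = 0")
  case True
  then show ?thesis using comm[of 0 k] by simp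
next
  case False
  then show ?thesis using weight_shift[of k 0] by simp
qed

lemma weight_eq: "f 0 k = f 0 0 - of_int k"
proof (cases "k = 0 \<or> f 0 k \<noteq> of_int k")
  case True
  then show ?thesis using weight_dichotomy[of k] by auto
next
  case False
  then have k: "k \<noteq> 0" "f 0 k = of_int k" by auto
  \<comment> \<open>The indices \<open>- k\<close> and \<open>2 * k\<close> sum to \<open>k\<close>,
    so a nonzero product in either order relates the known \<open>f 0 k\<close> to
    \<open>f 0 (2 * k)\<close> or \<open>f 0 (- k)\<close>.\<close>
  have "f (- k) (2 * k) \<noteq> 0 \<or> f (2 * k) (- k) \<noteq> 0"
    using comm[of "- k" "2 * k"] k(1) by auto
  then have "f 0 (2 * k) = 0 \<or> f 0 (- k) = 3 * of_int k"
    using weight_shift[of "- k" "2 * k"] weight_shift[of "2 * k" "- k"] k(2)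
    by (auto simp: algebra_simps)
  \<comment> \<open>For this \<open>f 0 0\<close> the two values allowed by the dichotomy at
    \<open>k\<close> coincide.\<close>
  then have "f 0 0 = 2 * of_int k"
    using weight_dichotomy[of "2 * k"] weight_dichotomy[of "- k"] k(1)
    by (auto simp: algebra_simps)
  with k(2) show ?thesis by simp
qed

text \<open>The second hypothesis is the central part of the module identity on index
  \<open>- a - b\<close>, the only index where \<open>c\<close> can appear.\<close>

lemma no_virasoro_cocycle:
  assumes central_comm: "\<And>n. \<psi> n - \<psi> (- n) = (of_int n ^ 3 - of_int n) / 12"
    and central_action:
      "\<And>a b. f b (- a - b) * \<psi> a - f a (- a - b) * \<psi> b = of_int (a - b) * \<psi> (a + b)"
  shows False
proof -
  have scaled: "f 0 0 * \<psi> b = f b (- b) * \<psi> 0" for b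
    using central_action[of b 0] weight_eq[of "- b"] by (simp add: algebra_simps)
  have diff: "f 0 0 * ((of_int b ^ 3 - of_int b) / 12) = - 2 * of_int b * \<psi> 0" for b
  proof -
    have "f 0 0 * (\<psi> b - \<psi> (- b)) = (f b (- b) - f (- b) b) * \<psi> 0"
      using scaled[of b] scaled[of "- b"] by (simp add: algebra_simps)
    then show ?thesis unfolding central_comm comm by simp
  qed
  \<comment> \<open>\<open>b = 2\<close> gives \<open>f 0 0 = - 8 * \<psi> 0\<close>, while
    \<open>b = 3\<close> gives \<open>f 0 0 = - 3 * \<psi> 0\<close>.\<close>
  have f00: "f 0 0 = 0" and \<psi>0: "\<psi> 0 = 0"
    using diff[of 2] diff[of 3] by (auto simp: field_simps)
  have f_0: "f k 0 = - 2 * of_int k" for k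
    using comm[of k 0] weight_eq[of k] f00
    by (simp add: eq_neg_iff_add_eq_0 algebra_simps)
  have \<psi>_odd: "\<psi> (- a) = - \<psi> a" if "a \<noteq> 0" for a
  proof -
    have "2 * of_int a * (\<psi> a + \<psi> (- a)) = 0"
      using central_action[of "- a" a] \<psi>0 f_0 by (simp add: algebra_simps)
    with that show ?thesis by (simp add: eq_neg_iff_add_eq_0 add.commute)
  qed
  have \<psi>_eq: "\<psi> 1 = 0" "\<psi> (- 2) = - 1 / 4" "\<psi> (- 3) = - 1"
    using central_comm[of 1] central_comm[of 2] central_comm[of 3]
      \<psi>_odd[of 1] \<psi>_odd[of 2] \<psi>_odd[of 3] by (simp_all add: field_simps)
  \<comment> \<open>The vanishing of \<open>\<psi> 1\<close> removes the unknown
    \<open>f (- 3) 2\<close>.\<close>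
  have "f 1 2 = - 1" using central_action[of 1 "- 3"] \<psi>_eq by (simp add: minus_equation_iff)
  moreover from this have "f 2 1 = - 2" using comm[of 1 2]
    by (simp add: eq_neg_iff_add_eq_0 algebra_simps)
  \<comment> \<open>The identity reads \<open>4 - 4 = 6\<close>.\<close>
  ultimately show False using action[of 2 0 1] by (simp add: f_0)
qed

end

text \<open>Distinct members of a basis are independent; this turns identities between products into
  scalar equations.\<close>

lemma (in virasoro_algebra) W_c_coeffs_eq:
  assumes "scale x (W k) + scale y c = scale x' (W k) + scale y' c"
  shows "x = x'" "y = y'"
proof -
  have ne: "W k \<noteq> c" using c_notin by auto
  have indep: "independent {W k, c}"
    by (rule independent_mono[OF basis_independent]) auto
  let ?u = "\<lambda>v. if v = c then y - y' else x - x'"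
  have "(\<Sum>v\<in>{W k, c}. scale (?u v) v) = 0"
    using assms ne by (simp add: scale_left_diff_distrib algebra_simps)
  from independentD[OF indep _ _ this] have "?u v = 0" if "v \<in> {W k, c}" for v
    using that by simp
  from this[of "W k"] this[of c] ne show "x = x'" "y = y'" by auto
qed

theorem theorem4p2:
  fixes scale :: "complex \<Rightarrow> 'a::ab_group_add \<Rightarrow> 'a"
    and bracket :: "'a \<Rightarrow> 'a \<Rightarrow> 'a"
    and W :: "int \<Rightarrow> 'a" and c :: 'a
  assumes "virasoro_algebra scale bracket W c"
  shows "\<not> (\<exists>circ. anti_pre_lie_structure_on scale bracket circ \<and>
    (\<exists>(\<phi>' :: int \<Rightarrow> int \<Rightarrow> complex) (\<phi> :: int \<Rightarrow> int \<Rightarrow> complex). \<forall>m n.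
      circ (W n) (W m)
        = scale (\<phi>' n m) (W (m + n)) + scale (\<phi> n m * of_bool (m + n = 0)) c \<and>
      circ (W n) c = 0 \<and> circ c (W n) = 0 \<and> circ c c = 0))"
proof
  assume "\<exists>circ. anti_pre_lie_structure_on scale bracket circ \<and>
    (\<exists>(\<phi>' :: int \<Rightarrow> int \<Rightarrow> complex) (\<phi> :: int \<Rightarrow> int \<Rightarrow> complex). \<forall>m n.
      circ (W n) (W m)
        = scale (\<phi>' n m) (W (m + n)) + scale (\<phi> n m * of_bool (m + n = 0)) c \<and>
      circ (W n) c = 0 \<and> circ c (W n) = 0 \<and> circ c c = 0)"
  then obtain circ \<phi>' \<phi> where struct: "anti_pre_lie_structure_on scale bracket circ"
    and W_W: "\<And>m n. circ (W n) (W m)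
        = scale (\<phi>' n m) (W (m + n)) + scale (\<phi> n m * of_bool (m + n = 0)) c"
    and W_c: "\<And>n. circ (W n) c = 0" and c_W: "\<And>n. circ c (W n) = 0"
    by blast
  interpret virasoro_algebra scale bracket W c by fact
  interpret A: anti_pre_lie_algebra scale circ
    using struct by (simp add: anti_pre_lie_structure_on_def)
  have bracket_eq: "circ x y - circ y x = bracket x y" for x y
    using struct by (simp add: anti_pre_lie_structure_on_def commutator_def)
  have circ_right: "circ x (scale r y + scale s z) = scale r (circ x y) + scale s (circ x z)"
    for x y z r s
    using A.linear_mul_right[of x]
    by (simp add: Vector_Spaces.linear_iff)
  have circ_left: "circ (scale r y + scale s z) x = scale r (circ y x) + scale s (circ z x)"
    for x y z r s
    using A.linear_mul_left[of x]
    by (simp add: Vector_Spaces.linear_iff)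

  have comm: "\<phi>' m n - \<phi>' n m = of_int (n - m)"
    and central_comm: "\<phi> m n * of_bool (m + n = 0) - \<phi> n m * of_bool (m + n = 0)
      = of_bool (m + n = 0) * ((of_int m ^ 3 - of_int m) / 12)" for m n
  proof -
    have "scale (\<phi>' m n - \<phi>' n m) (W (m + n))
        + scale (\<phi> m n * of_bool (m + n = 0) - \<phi> n m * of_bool (m + n = 0)) c
      = circ (W m) (W n) - circ (W n) (W m)"
      unfolding W_W scale_left_diff_distrib add.commute[of n m] by (simp add: algebra_simps)
    also have "\<dots> = scale (of_int (n - m)) (W (m + n))
      + scale (of_bool (m + n = 0) * ((of_int m ^ 3 - of_int m) / 12)) c"
      unfolding bracket_eq bracket_W_W ..
    finally show "\<phi>' m n - \<phi>' n m = of_int (n - m)"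
      "\<phi> m n * of_bool (m + n = 0) - \<phi> n m * of_bool (m + n = 0)
        = of_bool (m + n = 0) * ((of_int m ^ 3 - of_int m) / 12)"
      by (rule W_c_coeffs_eq)+
  qed

  have action: "\<phi>' b k * \<phi>' a (b + k) - \<phi>' a k * \<phi>' b (a + k) = of_int (a - b) * \<phi>' (a + b) k"
    and central_action: "(\<phi>' b k * \<phi> a (b + k) - \<phi>' a k * \<phi> b (a + k)) * of_bool (a + b + k = 0)
      = of_int (a - b) * \<phi> (a + b) k * of_bool (a + b + k = 0)" for a b k
  proof -
    \<comment> \<open>\<open>W_c\<close> annihilates the central term of the inner product.\<close>
    have circ2: "circ (W i) (circ (W j) (W k)) = scale (\<phi>' j k * \<phi>' i (j + k)) (W (i + j + k))
      + scale (\<phi>' j k * \<phi> i (j + k) * of_bool (i + j + k = 0)) c" for i j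
      unfolding W_W[of j k] circ_right W_W W_c
      by (simp add: scale_right_distrib ac_simps)
    have "scale (\<phi>' b k * \<phi>' a (b + k) - \<phi>' a k * \<phi>' b (a + k)) (W (a + b + k))
        + scale ((\<phi>' b k * \<phi> a (b + k) - \<phi>' a k * \<phi> b (a + k)) * of_bool (a + b + k = 0)) c
      = circ (W a) (circ (W b) (W k)) - circ (W b) (circ (W a) (W k))"
      unfolding circ2 scale_left_diff_distrib left_diff_distrib add.commute[of b a]
      by (simp add: algebra_simps)
    also have "\<dots> = circ (bracket (W b) (W a)) (W k)"
      unfolding A.anti_pre_lie commutator_def bracket_eq ..
    also have "\<dots> = scale (of_int (a - b) * \<phi>' (a + b) k) (W (a + b + k))
        + scale (of_int (a - b) * \<phi> (a + b) k * of_bool (a + b + k = 0)) c"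
      \<comment> \<open>By \<open>c_W\<close> the cocycle term of the bracket acts as zero, leaving
        a Witt action.\<close>
      unfolding bracket_W_W circ_left c_W W_W
      by (simp add: scale_right_distrib ac_simps)
    finally show
      "\<phi>' b k * \<phi>' a (b + k) - \<phi>' a k * \<phi>' b (a + k) = of_int (a - b) * \<phi>' (a + b) k"
      "(\<phi>' b k * \<phi> a (b + k) - \<phi>' a k * \<phi> b (a + k)) * of_bool (a + b + k = 0)
        = of_int (a - b) * \<phi> (a + b) k * of_bool (a + b + k = 0)"
      by (rule W_c_coeffs_eq)+
  qed

  show False
  proof (rule no_virasoro_cocycle[of \<phi>' "\<lambda>n. \<phi> n (- n)", OF comm action])
    show "\<phi> n (- n) - \<phi> (- n) (- (- n)) = (of_int n ^ 3 - of_int n) / 12" for n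
      using central_comm[of n "- n"] by simp
    \<comment> \<open>Choosing \<open>k = - a - b\<close> makes the delta factor 1, with
      \<open>b + k = - a\<close> and \<open>a + k = - b\<close>.\<close>
    show "\<phi>' b (- a - b) * \<phi> a (- a) - \<phi>' a (- a - b) * \<phi> b (- b)
        = of_int (a - b) * \<phi> (a + b) (- (a + b))" for a b
      using central_action[of b "- a - b" a] by simp
  qed
qed

end
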